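(* Let $q$ be a prime power and $\varepsilon\in\{-1,+1\}$. Then, as formal power series in $x$, $$\Big(1+\sum_{n^-\geq1}\Big[\sum_{\lambda^-\vdash n^-}\prod_{d^-\in B(\lambda^-)}\binom{\varepsilon\,\mathrm{SDIM}^-_{d^-}(q)}{-E(\lambda^-,d^-)}\Big]x^{n^-}\Big)\Big(1+\sum_{n^+\geq1}\Big[\sum_{\lambda^+\vdash n^+}\prod_{d^+\in B(\lambda^+)}\binom{\varepsilon\,\mathrm{SDIM}^+_{d^+}(q)}{-E(\lambda^+,d^+)}\Big]x^{2n^+}\Big)=\Big(\frac{1-qx}{1+x}\Big)^{\varepsilon}.$$
   Context: For a monic polynomial $f(x)=\sum_{i=0}^d a_ix^i\in\mathbf{F}_{q^2}[x]$ of degree $d$ with $a_0\neq0$, its dual is $\tilde f(x)=\bar a_0^{-1}x^d\bar f(x^{-1})$, where $\bar f$ is obtained by applying $a\mapsto a^q$ to the coefficients; $f$ is self-dual if $\tilde f=f$. $\mathrm{SDIM}^-_d(q)$ is the number of self-dual irreducible monic polynomials of degree $d$ over $\mathbf{F}_{q^2}$, and $\mathrm{SDIM}^+_d(q)$ the number of unordered pairs $\{f,\tilde f\}$ of non-self-dual irreducible monic polynomials of degree $d$ over $\mathbf{F}_{q^2}$ with $f(0)\neq0$. For a partition $\lambda$, $B(\lambda)$ is its set of distinct parts and $E(\lambda,d)$ the multiplicity of $d$. For $m\in\mathbf{Q}$ (or $\mathbf{Q}[q]$) and $k\geq0$, $\binom{m}{k}=m(m-1)\cdots(m-k+1)/k!$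 and $\binom{m}{-k}=(-1)^k\binom{m}{k}$. *)

theory Defs
  imports
    "HOL-Computational_Algebra.Polynomial"
    "HOL-Computational_Algebra.Formal_Power_Series"
    "HOL-Number_Theory.Prime_Powers"
    "HOL-Library.Multiset"
    "HOL-Library.Cardinality"
begin

text \<open>
  The field with \<open>q\<^sup>2\<close> elements is a type \<open>'a :: {field, finite}\<close> with \<open>CARD('a) = q\<^sup>2\<close>; the
  definitions below take \<open>q\<close> as an extra argument and are meant for that situation only.
\<close>

definition conj_poly :: "nat \<Rightarrow> 'a::field poly \<Rightarrow> 'a poly" where
  "conj_poly q f = map_poly (\<lambda>a. a ^ q) f"

text \<open>
  \<^term>\<open>reflect_poly p\<close> is \<open>x\<^sup>d p(x\<^sup>-\<^sup>1)\<close> with \<open>d = degree p\<close>, and conjugation preserves the degree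
  for \<open>q > 0\<close>.
\<close>

definition dual_poly :: "nat \<Rightarrow> 'a::field poly \<Rightarrow> 'a poly" where
  "dual_poly q f = smult (inverse (coeff f 0 ^ q)) (reflect_poly (conj_poly q f))"

definition self_dual :: "nat \<Rightarrow> 'a::field poly \<Rightarrow> bool" where
  "self_dual q f \<longleftrightarrow> dual_poly q f = f"

definition monic_irreducibles :: "nat \<Rightarrow> 'a::field poly set" where
  "monic_irreducibles d =
     {f. lead_coeff f = 1 \<and> irreducible f \<and> degree f = d \<and> coeff f 0 \<noteq> 0}"

definition SDIM_minus :: "'a::{field,finite} itself \<Rightarrow> nat \<Rightarrow> nat \<Rightarrow> nat" where
  "SDIM_minus _ q d = card {f :: 'a poly. f \<in> monic_irreducibles d \<and> self_dual q f}"

definition SDIM_plus :: "'a::{field,finite} itself \<Rightarrow> nat \<Rightarrow> nat \<Rightarrow> nat" where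
  "SDIM_plus _ q d =
     card {{f, dual_poly q f} | f :: 'a poly. f \<in> monic_irreducibles d \<and> \<not> self_dual q f}"

text \<open>
  A partition is the multiset of its parts, so \<open>B(\<mu>)\<close> is \<^term>\<open>set_mset \<mu>\<close> and \<open>E(\<mu>, d)\<close> is
  \<^term>\<open>count \<mu> d\<close>.
\<close>

definition partitions :: "nat \<Rightarrow> nat multiset set" where
  "partitions n = {\<mu>. 0 \<notin># \<mu> \<and> sum_mset \<mu> = n}"

lemma finite_partitions: "finite (partitions n)"
proof -
  have size: "size M \<le> sum_mset M" if "0 \<notin># M" for M :: "nat multiset"
    using that by (induction M) auto
  have "partitions n \<subseteq> mset ` {xs. set xs \<subseteq> {..n} \<and> length xs \<le> n}"
  proof
    fix M assume M: "M \<in> partitions n"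
    obtain xs where xs: "M = mset xs" using ex_mset by metis
    have "length xs \<le> n"
      using M size[of M] by (simp add: partitions_def xs)
    moreover have "set xs \<subseteq> {..n}"
      using M member_le_sum_list[of _ xs]
      by (auto simp: partitions_def xs sum_mset_sum_list)
    ultimately show "M \<in> mset ` {xs. set xs \<subseteq> {..n} \<and> length xs \<le> n}"
      using xs by blast
  qed
  then show ?thesis
    using finite_lists_length_le[of "{..n}" n] finite_surj by blast
qed

text \<open>
  Here \<open>int_binom m (-k) = (-1)\<^sup>k int_binom m k\<close> for \<open>k \<ge> 0\<close>, which is not the usual convention for
  negative lower index.
\<close>

definition int_binom :: "rat \<Rightarrow> int \<Rightarrow> rat" where
  "int_binom m k =
     (if k \<ge> 0 then m gchoose nat k else (- 1) ^ nat (- k) * (m gchoose nat (- k)))"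

definition partition_coeff :: "int \<Rightarrow> (nat \<Rightarrow> nat) \<Rightarrow> nat \<Rightarrow> rat" where
  "partition_coeff \<epsilon> S n =
     (\<Sum>\<mu>\<in>partitions n. \<Prod>d\<in>set_mset \<mu>. int_binom (of_int (\<epsilon> * int (S d))) (- int (count \<mu> d)))"

end

theory Submission
  imports
    Defs
    "HOL-Computational_Algebra.Polynomial_Factorial"
    "HOL-Computational_Algebra.Formal_Laurent_Series"
begin

text \<open>
  Up to any given order, the left-hand side is the \<open>\<epsilon>\<close>-th power of the product over \<open>d\<close> of
  \<open>(1 - x^d)^a (1 - x^(2d))^b\<close>, where \<open>a = SDIM_minus d\<close> and \<open>b = SDIM_plus d\<close>. Call \<open>{f, g}\<close> an orbit
  if \<open>f\<close> is monic irreducible with \<open>f(0) \<noteq> 0\<close> and \<open>g\<close> is its dual. By unique factorization every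
  self-dual monic polynomial is the product of a unique multiset of orbits, each orbit contributing
  the product of its elements, of degree \<open>d\<close> or \<open>2d\<close>. So for \<open>\<epsilon> = -1\<close> the left-hand side is the
  generating function of the number of self-dual monic polynomials of degree \<open>n\<close>. That number is
  \<open>(q + 1) q^(n - 1)\<close> for \<open>n \<ge> 1\<close>, which gives \<open>(1 + x) / (1 - q x)\<close>; the case \<open>\<epsilon> = 1\<close> is inverse
  to it.
\<close>

subsection \<open>Generating functions of weighted multisets\<close>

text \<open>Covers two uses: partitions, with weights proportional to the parts, and multisets of
  orbits, weighted by the degree of the orbit product.\<close>

definition weighted_multisets :: "'b set \<Rightarrow> ('b \<Rightarrow> nat) \<Rightarrow> nat \<Rightarrow> 'b multiset set" where
  "weighted_multisets A w n = {M. set_mset M \<subseteq> A \<and> (\<Sum>a\<in>#M. w a) = n}"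

lemma weighted_multisets_empty: "weighted_multisets {} w n = (if n = 0 then {{#}} else {})"
  by (auto simp: weighted_multisets_def)

text \<open>A multiset over \<open>insert a A\<close> amounts to the multiplicity \<open>k\<close>
  of \<open>a\<close> together with a multiset over \<open>A\<close>, and the weights add.\<close>

lemma weighted_multisets_insert:
  assumes "a \<notin> A" and "w a > 0"
  shows "bij_betw (\<lambda>(k, M). replicate_mset k a + M)
           (SIGMA k:{k. k * w a \<le> n}. weighted_multisets A w (n - k * w a))
           (weighted_multisets (insert a A) w n)"
proof (rule bij_betwI[where g = "\<lambda>M. (count M a, filter_mset (\<lambda>x. x \<noteq> a) M)"])
  show "(\<lambda>(k, M). replicate_mset k a + M)
    \<in> (SIGMA k:{k. k * w a \<le> n}. weighted_multisets A w (n - k * w a)) \<rightarrow> weighted_multisets (insert a A) w n"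
    by (auto simp: weighted_multisets_def in_replicate_mset sum_mset_replicate_mset split: if_splits)
  have split: "replicate_mset (count M a) a + filter_mset (\<lambda>x. x \<noteq> a) M = M" for M
    by (intro multiset_eqI) auto
  show "(\<lambda>M. (count M a, filter_mset (\<lambda>x. x \<noteq> a) M)) \<in> weighted_multisets (insert a A) w n
    \<rightarrow> (SIGMA k:{k. k * w a \<le> n}. weighted_multisets A w (n - k * w a))"
  proof
    fix M assume M: "M \<in> weighted_multisets (insert a A) w n"
    have "count M a * w a + (\<Sum>x\<in>#filter_mset (\<lambda>x. x \<noteq> a) M. w x) = (\<Sum>x\<in>#M. w x)"
      by (subst (3) split[of M, symmetric]) (simp add: sum_mset_replicate_mset)
    with M show "(count M a, filter_mset (\<lambda>x. x \<noteq> a) M)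
        \<in> (SIGMA k:{k. k * w a \<le> n}. weighted_multisets A w (n - k * w a))"
      by (auto simp: weighted_multisets_def)
  qed
  show "(count (case x of (k, M) \<Rightarrow> replicate_mset k a + M) a,
         filter_mset (\<lambda>x. x \<noteq> a) (case x of (k, M) \<Rightarrow> replicate_mset k a + M)) = x"
    if "x \<in> (SIGMA k:{k. k * w a \<le> n}. weighted_multisets A w (n - k * w a))" for x
  proof (cases x)
    case (Pair k M)
    with that assms(1) have "a \<notin># M"
      by (auto simp: weighted_multisets_def)
    then show ?thesis
      by (auto simp: Pair not_in_iff intro!: multiset_eqI)
  qed
  show "(case (count M a, filter_mset (\<lambda>x. x \<noteq> a) M) of (k, M) \<Rightarrow> replicate_mset k a + M) = M" for M
    by (simp add: split)
qed

text \<open>Multiplying out means picking a term \<open>c a k * x ^ (k * w a)\<close> from every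
  factor, and such choices are the multiplicities of a multiset. Finiteness is carried along for the
  double sum in the induction step.\<close>

lemma fps_nth_prod_weighted_multisets:
  fixes c :: "'b \<Rightarrow> nat \<Rightarrow> 'c::comm_ring_1"
  assumes "finite A" and "\<And>a. a \<in> A \<Longrightarrow> w a > 0"
  shows "finite (weighted_multisets A w n) \<and>
    (\<Prod>a\<in>A. Abs_fps (c a) oo fps_X ^ w a) $ n
      = (\<Sum>M\<in>weighted_multisets A w n. \<Prod>a\<in>A. c a (count M a))"
  using assms
proof (induction A arbitrary: n rule: finite_induct)
  case empty
  then show ?case by (simp add: weighted_multisets_empty)
next
  case (insert a A)
  let ?K = "{k. k * w a \<le> n}"
  have wa: "w a > 0" using insert.prems by simp
  have "?K \<subseteq> {..n}"
    using wa by auto (metis le_trans mult.right_neutral mult_le_mono2 Suc_leI One_nat_def)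
  then have fin: "finite ?K" using finite_subset by blast
  note bij = weighted_multisets_insert[where w = w and n = n, OF insert.hyps(2) wa]
  have IH: "finite (weighted_multisets A w m)"
    "(\<Prod>a\<in>A. Abs_fps (c a) oo fps_X ^ w a) $ m
      = (\<Sum>M\<in>weighted_multisets A w m. \<Prod>a\<in>A. c a (count M a))" for m
    using insert.IH[of m] insert.prems by auto
  have "(\<Prod>a\<in>insert a A. Abs_fps (c a) oo fps_X ^ w a) $ n
     = (\<Sum>i\<le>n. (if w a dvd i then c a (i div w a) else 0) * (\<Prod>a\<in>A. Abs_fps (c a) oo fps_X ^ w a) $ (n - i))"
    using insert.hyps by (simp add: fps_mult_nth fps_nth_compose_X_power atLeast0AtMost
        cong: if_cong)
  \<comment> \<open>The factor for \<open>a\<close> has nonzero coefficients only at multiples of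
    \<open>w a\<close>.\<close>
  also have "\<dots> = (\<Sum>i\<in>(\<lambda>k. k * w a) ` ?K. (if w a dvd i then c a (i div w a) else 0) * (\<Prod>a\<in>A. Abs_fps (c a) oo fps_X ^ w a) $ (n - i))"
    by (intro sum.mono_neutral_right) (auto simp: image_iff mult.commute elim!: dvdE)
  also have "\<dots> = (\<Sum>k\<in>?K. c a k * (\<Prod>a\<in>A. Abs_fps (c a) oo fps_X ^ w a) $ (n - k * w a))"
    using wa by (subst sum.reindex) (auto simp: inj_on_def)
  also have "\<dots> = (\<Sum>(k, M)\<in>(SIGMA k:?K. weighted_multisets A w (n - k * w a)). c a k * (\<Prod>a\<in>A. c a (count M a)))"
    using fin IH by (simp add: sum_distrib_left sum.Sigma)
  also have "\<dots> = (\<Sum>M\<in>weighted_multisets (insert a A) w n. \<Prod>a\<in>insert a A. c a (count M a))"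
  proof (subst sum.reindex_bij_betw[OF bij, symmetric], rule sum.cong[OF refl], clarify)
    fix k M assume M: "M \<in> weighted_multisets A w (n - k * w a)"
    then have "count M a = 0"
      using insert.hyps(2) by (auto simp: weighted_multisets_def not_in_iff)
    moreover have "(\<Prod>b\<in>A. c b (count (replicate_mset k a + M) b)) = (\<Prod>b\<in>A. c b (count M b))"
      using insert.hyps(2) by (intro prod.cong) auto
    ultimately show "c a k * (\<Prod>a\<in>A. c a (count M a))
       = (\<Prod>b\<in>insert a A. c b (count (replicate_mset k a + M) b))"
      using insert.hyps by simp
  qed
  finally show ?case
    using bij_betw_finite[OF bij] fin IH(1) by auto
qed

section \<open>Partitions and truncated products\<close>

text \<open>The parts of a partition of \<open>n\<close> are at most \<open>n\<close>, so a finite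
  product over \<open>{1..N}\<close> sees all of them. The scaling \<open>r\<close> is 1 for the
  first factor of the theorem and 2 for the second.\<close>

lemma partitions_eq_weighted_multisets:
  assumes "n \<le> N" and "r > 0"
  shows "partitions n = weighted_multisets {1..N} (\<lambda>d. r * d) (r * n)"
proof -
  have "d \<in> {1..N}" if "0 \<notin># M" "sum_mset M \<le> N" "d \<in># M" for d and M :: "nat multiset"
    using that by (auto dest!: multi_member_split simp: Suc_le_eq intro: gr0I)
  then show ?thesis
    using assms
    by (auto simp: partitions_def weighted_multisets_def simp flip: sum_mset_distrib_left)
qed

lemma int_binom_0: "int_binom m 0 = 1"
  by (simp add: int_binom_def)

lemma fps_nth_partition_product:
  assumes "n \<le> N" and "r > 0"
  shows "(\<Prod>d=1..N. Abs_fps (\<lambda>k. int_binom (of_int (\<epsilon> * int (S d))) (- int k)) oo fps_X ^ (r * d)) $ n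
    = (if r dvd n then partition_coeff \<epsilon> S (n div r) else 0)"
proof -
  let ?c = "\<lambda>d k. int_binom (of_int (\<epsilon> * int (S d))) (- int k)"
  have *: "(\<Prod>d=1..N. Abs_fps (?c d) oo fps_X ^ (r * d)) $ n
      = (\<Sum>M\<in>weighted_multisets {1..N} (\<lambda>d. r * d) n. \<Prod>d=1..N. ?c d (count M d))"
    using fps_nth_prod_weighted_multisets[of "{1..N}" "\<lambda>d. r * d" n ?c] assms(2) by auto
  show ?thesis
  proof (cases "r dvd n")
    case True
    then obtain m where m: "n = r * m" by blast
    with assms have "m \<le> N"
      by (metis One_nat_def Suc_leI dual_order.trans mult_le_mono1 mult_1)
    \<comment> \<open>A \<open>d\<close> that is not a part contributes
      \<open>int_binom m 0 = 1\<close>, so only the distinct parts remain.\<close>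
    have "(\<Prod>d=1..N. ?c d (count M d)) = (\<Prod>d\<in>set_mset M. ?c d (count M d))"
      if "M \<in> partitions m" for M
      using that \<open>m \<le> N\<close> partitions_eq_weighted_multisets[of m N r] assms(2)
      by (intro prod.mono_neutral_right) (auto simp: weighted_multisets_def not_in_iff int_binom_0)
    then show ?thesis
      using partitions_eq_weighted_multisets[OF \<open>m \<le> N\<close> assms(2)] assms(2)
      unfolding * by (simp add: m partition_coeff_def)
  next
    case False
    then have "weighted_multisets {1..N} (\<lambda>d. r * d) n = {}"
      by (auto simp: weighted_multisets_def simp flip: sum_mset_distrib_left)
    with False show ?thesis unfolding * by simp
  qed
qed

text \<open>The sign \<open>(- 1) ^ k\<close> in the convention for negative lower index gives the
  binomial series at \<open>- x\<close>.\<close>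

lemma Abs_fps_int_binom_of_nat:
  "Abs_fps (\<lambda>k. int_binom (of_nat s) (- int k)) = (1 - fps_X) ^ s"
  "Abs_fps (\<lambda>k. int_binom (- of_nat s) (- int k)) = inverse ((1 - fps_X) ^ s)"
proof -
  have *: "Abs_fps (\<lambda>k. int_binom m (- int k)) = fps_binomial m oo (- fps_X)" for m
    by (auto simp: fps_compose_uminus' int_binom_def fps_eq_iff)
  show "Abs_fps (\<lambda>k. int_binom (of_nat s) (- int k)) = (1 - fps_X) ^ s"
    unfolding * fps_binomial_of_nat
    by (simp add: fps_compose_add_distrib flip: fps_compose_power)
  show "Abs_fps (\<lambda>k. int_binom (- of_nat s) (- int k)) = inverse ((1 - fps_X) ^ s)"
    unfolding * fps_binomial_minus_of_nat
    by (simp add: fps_inverse_compose fps_compose_add_distrib flip: fps_compose_power)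
qed

lemma fps_nth_mult_cong:
  assumes "\<And>i. i \<le> n \<Longrightarrow> f $ i = f' $ i" and "\<And>i. i \<le> n \<Longrightarrow> g $ i = g' $ i"
  shows "(f * g) $ n = (f' * g') $ n"
  using assms by (simp add: fps_mult_nth)

lemma partition_coeff_0: "partition_coeff \<epsilon> S 0 = 1"
proof -
  have "partitions 0 = {{#}}"
    by (auto simp: partitions_def) (metis multiset_nonemptyE)
  then show ?thesis
    by (simp add: partition_coeff_def)
qed

lemma one_minus_X_compose_X_power:
  "w > 0 \<Longrightarrow> (1 - fps_X) oo fps_X ^ w = (1 - fps_X ^ w :: rat fps)"
  by (simp add: fps_compose_sub_distrib fps_X_power_compose)

lemma int_binom_factor_compose:
  assumes "w > 0"
  shows "Abs_fps (\<lambda>k. int_binom (of_int (1 * int s)) (- int k)) oo fps_X ^ w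
           = (1 - fps_X ^ w) ^ s"
    and "Abs_fps (\<lambda>k. int_binom (of_int (- 1 * int s)) (- int k)) oo fps_X ^ w
           = inverse (1 - fps_X ^ w) ^ s"
  using assms
  by (simp_all add: Abs_fps_int_binom_of_nat fps_inverse_compose fps_inverse_power
      one_minus_X_compose_X_power flip: fps_compose_power)

text \<open>
  The exponents \<open>1 * d\<close> and \<open>2 * d\<close> make both factors instances of \<open>fps_nth_partition_product\<close>.
\<close>

definition truncated_product :: "int \<Rightarrow> (nat \<Rightarrow> nat) \<Rightarrow> (nat \<Rightarrow> nat) \<Rightarrow> nat \<Rightarrow> rat fps" where
  "truncated_product \<epsilon> S S' N =
     (\<Prod>d=1..N. Abs_fps (\<lambda>k. int_binom (of_int (\<epsilon> * int (S d))) (- int k)) oo fps_X ^ (1 * d)) *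
     (\<Prod>d=1..N. Abs_fps (\<lambda>k. int_binom (of_int (\<epsilon> * int (S' d))) (- int k)) oo fps_X ^ (2 * d))"

lemma truncated_product_1:
  "truncated_product 1 S S' N
     = (\<Prod>d=1..N. (1 - fps_X ^ d) ^ S d) * (\<Prod>d=1..N. (1 - fps_X ^ (2 * d)) ^ S' d)"
  unfolding truncated_product_def
  by (intro arg_cong2[where f = "(*)"] prod.cong refl) (subst int_binom_factor_compose(1), simp, simp)+

lemma truncated_product_minus_1:
  "truncated_product (- 1) S S' N
     = (\<Prod>d=1..N. inverse (1 - fps_X ^ d) ^ S d) * (\<Prod>d=1..N. inverse (1 - fps_X ^ (2 * d)) ^ S' d)"
  unfolding truncated_product_def
  by (intro arg_cong2[where f = "(*)"] prod.cong refl) (subst int_binom_factor_compose(2), simp, simp)+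

text \<open>The counting argument treats \<epsilon> = -1; this identity transfers its result to
  \<epsilon> = 1.\<close>

lemma truncated_product_mult: "truncated_product 1 S S' N * truncated_product (- 1) S S' N = 1"
proof -
  have *: "(1 - fps_X ^ w :: rat fps) ^ s * inverse (1 - fps_X ^ w) ^ s = 1" if "w > 0" for w s
    using that by (simp add: inverse_mult_eq_1' flip: power_mult_distrib)
  have "truncated_product 1 S S' N * truncated_product (- 1) S S' N =
    (\<Prod>d=1..N. (1 - fps_X ^ d) ^ S d * inverse (1 - fps_X ^ d) ^ S d) *
    (\<Prod>d=1..N. (1 - fps_X ^ (2 * d)) ^ S' d * inverse (1 - fps_X ^ (2 * d)) ^ S' d)"
    by (simp only: truncated_product_1 truncated_product_minus_1 prod.distrib mult_ac)
  also have "\<dots> = 1"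
    using * by simp
  finally show ?thesis .
qed

definition partition_series :: "int \<Rightarrow> (nat \<Rightarrow> nat) \<Rightarrow> rat fps" where
  "partition_series \<epsilon> S = 1 + Abs_fps (\<lambda>n. if n \<ge> 1 then partition_coeff \<epsilon> S n else 0)"

lemma partition_series_nth: "partition_series \<epsilon> S $ n = partition_coeff \<epsilon> S n"
  by (cases n) (simp_all add: partition_series_def partition_coeff_0)

text \<open>A coefficient of a product depends only on coefficients up to the same index, and up to
  \<open>N\<close> each factor agrees with its finite product.\<close>

lemma partition_series_mult_nth:
  assumes "n \<le> N"
  shows "(partition_series \<epsilon> S * (partition_series \<epsilon> S' oo fps_X ^ 2)) $ n
     = truncated_product \<epsilon> S S' N $ n"
  unfolding truncated_product_def
  using assms
  by (intro fps_nth_mult_cong)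
     (simp_all only: fps_nth_partition_product fps_nth_compose_X_power partition_series_nth
       zero_less_one zero_less_numeral one_dvd div_by_1 if_True order_trans)

subsection \<open>Norms and twisted fixed points in a quadratic extension of finite fields\<close>

text \<open>Multiplication by a nonzero \<open>x\<close> permutes the nonzero elements; comparing
  the products over them gives \<open>x ^ (CARD('a) - 1) = 1\<close>.\<close>

lemma power_card_UNIV_field: "x ^ CARD('a) = x" for x :: "'a::{field,finite}"
proof (cases "x = 0")
  case False
  let ?U = "UNIV - {0::'a}"
  have "(\<Prod>y\<in>?U. y) = (\<Prod>y\<in>?U. x * y)"
    using False by (intro prod.reindex_bij_witness[of _ "\<lambda>y. x * y" "\<lambda>y. y / x"]) auto
  then have "x ^ (CARD('a) - 1) = 1"
    by (simp add: prod.distrib)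
  then show ?thesis
    by (subst power_eq_if) simp
qed simp

text \<open>
  The two root counts below apply this to a map given by a polynomial of degree \<open>k\<close> whose image
  consists of roots of a polynomial of degree \<open>m\<close>: since \<open>k m\<close> is the size of the domain, all root
  bounds are attained.
\<close>

lemma card_fibre_eq_of_bounds:
  assumes "finite A" and "card A = k * m" and "card (f ` A) \<le> m"
    and fibre: "\<And>y. card {x \<in> A. f x = y} \<le> k" and "y \<in> f ` A"
  shows "card {x \<in> A. f x = y} = k"
proof (rule ccontr)
  assume "card {x \<in> A. f x = y} \<noteq> k"
  then have less: "card {x \<in> A. f x = y} < k"
    using fibre[of y] by simp
  have "k * m = (\<Sum>y\<in>f ` A. card {x \<in> A. f x = y})"
    using sum.image_gen[OF assms(1), of "\<lambda>_. 1::nat" f] assms(2) by simp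
  also have "\<dots> < (\<Sum>y\<in>f ` A. k)"
    using assms(1,5) less fibre by (intro sum_strict_mono_ex1) auto
  also have "\<dots> \<le> k * m"
    using assms(3) by simp
  finally show False by simp
qed

locale quadratic_field =
  fixes q :: nat and ty :: "'a::{field,finite} itself"
  assumes q: "primepow q" and card_field: "CARD('a) = q ^ 2"
begin

lemma q_gt_1: "q > 1"
  using q primepow_gt_Suc_0 by auto

lemma power_q_power_q: "(x ^ q) ^ q = x" for x :: 'a
  using power_card_UNIV_field[of x] by (simp add: card_field power2_eq_square power_mult)

text \<open>Makes the \<open>q\<close>-th power map a power of the Frobenius map, hence
  additive.\<close>

lemma q_eq_CHAR_power: "prime CHAR('a)" "\<exists>k. q = CHAR('a) ^ k"
proof -
  show prime: "prime CHAR('a)"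
    by (simp add: finite_imp_CHAR_pos prime_CHAR_semidom)
  from q obtain p k where pk: "prime p" "q = p ^ k"
    by (auto simp: primepow_def)
  \<comment> \<open>Translation by 1 permutes the field, so \<open>CARD('a)\<close> times 1
    vanishes.\<close>
  have "(\<Sum>x::'a\<in>UNIV. x) = (\<Sum>x\<in>UNIV. x + 1)"
    by (rule sum.reindex_bij_witness[of _ "\<lambda>x. x + 1" "\<lambda>x. x - 1"]) auto
  then have "of_nat CARD('a) = (0::'a)"
    by (simp add: sum.distrib)
  then have "CHAR('a) dvd p ^ (k * 2)"
    by (simp add: of_nat_eq_0_iff_char_dvd card_field pk power_mult del: of_nat_power)
  then have "CHAR('a) = p"
    using prime pk(1) prime_dvd_power primes_dvd_imp_eq by blast
  with pk show "\<exists>k. q = CHAR('a) ^ k" by blast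
qed

lemma add_power_q: "(x + y) ^ q = x ^ q + y ^ q" for x y :: 'a
  using q_eq_CHAR_power freshmans_dream' by blast

lemma sum_power_q: "sum f A ^ q = (\<Sum>i\<in>A. f i ^ q)" for f :: "'b \<Rightarrow> 'a"
  using q_eq_CHAR_power freshmans_dream_sum' by blast

lemma diff_power_q: "(x - y) ^ q = x ^ q - y ^ q" for x y :: 'a
  using add_power_q[of "x - y" y] by (simp add: algebra_simps)

text \<open>The norm \<open>x ^ Suc q\<close> maps the \<open>(q + 1) * (q - 1)\<close> nonzero
  elements into the roots of \<open>x ^ (q - 1) = 1\<close>. There are at most \<open>q - 1\<close>
  values with at most \<open>q + 1\<close> preimages each, so the fibre over 1 has full
  size.\<close>

lemma card_norm_one: "card {x::'a. x ^ Suc q = 1} = Suc q"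
proof -
  let ?A = "UNIV - {0::'a}"
  have "card {x \<in> ?A. x ^ Suc q = 1} = Suc q"
  proof (rule card_fibre_eq_of_bounds[where m = "q - 1"])
    show "card ?A = Suc q * (q - 1)"
      using q_gt_1 by (simp add: card_field algebra_simps power2_eq_square)
    have "card {x. poly (monom 1 (q - 1) - 1) x = (0::'a)} \<le> degree (monom (1::'a) (q - 1) - 1)"
      using q_gt_1 by (intro card_poly_roots_bound) (auto simp: poly_eq_iff intro!: exI[of _ "q - 1"])
    also have "\<dots> \<le> q - 1"
      by (intro degree_diff_le degree_monom_le) auto
    finally have *: "card {x::'a. x ^ (q - 1) = 1} \<le> q - 1"
      by (simp add: poly_monom)
    have "(\<lambda>x. x ^ Suc q) ` ?A \<subseteq> {x. x ^ (q - 1) = 1}"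
    proof clarify
      fix x :: 'a assume "x \<noteq> 0"
      have "(x ^ Suc q) ^ (q - 1) * x ^ Suc q = (x ^ Suc q) ^ q"
        using q_gt_1 by (intro power_minus_mult) simp
      also have "\<dots> = x ^ Suc q"
        by (simp add: power_mult_distrib power_q_power_q)
      finally have "(x ^ Suc q) ^ (q - 1) * x ^ Suc q = x ^ Suc q" .
      with \<open>x \<noteq> 0\<close> show "(x ^ Suc q) ^ (q - 1) = 1" by simp
    qed
    then have "card ((\<lambda>x. x ^ Suc q) ` ?A) \<le> card {x::'a. x ^ (q - 1) = 1}"
      by (intro card_mono) auto
    then show "card ((\<lambda>x. x ^ Suc q) ` ?A) \<le> q - 1"
      using * by (rule le_trans)
    show "card {x \<in> ?A. x ^ Suc q = y} \<le> Suc q" for y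
    proof -
      have "card {x. poly (monom 1 (Suc q) - [:y:]) x = 0} \<le> degree (monom 1 (Suc q) - [:y:])"
        by (intro card_poly_roots_bound) (auto simp: poly_eq_iff intro!: exI[of _ "Suc q"])
      also have "\<dots> \<le> Suc q"
        by (intro degree_diff_le degree_monom_le) auto
      finally have "card {x::'a. x ^ Suc q = y} \<le> Suc q"
        by (simp add: poly_monom)
      moreover have "card {x \<in> ?A. x ^ Suc q = y} \<le> card {x. x ^ Suc q = y}"
        by (intro card_mono) auto
      ultimately show ?thesis by linarith
    qed
    show "1 \<in> (\<lambda>x. x ^ Suc q) ` ?A"
      by (auto intro!: image_eqI[of _ _ 1])
  qed simp
  also have "{x \<in> ?A. x ^ Suc q = 1} = {x. x ^ Suc q = 1}"
    by auto
  finally show ?thesis .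
qed

text \<open>The values \<open>y\<close> of the map sending \<open>x\<close> to
  \<open>c * x ^ q - x\<close> satisfy \<open>c * y ^ q + y = 0\<close>. So there are at most
  \<open>q\<close> values with at most \<open>q\<close> preimages each, while the field has
  \<open>q * q\<close> elements; the required set is the fibre over 0.\<close>

lemma card_twisted_fixed_points:
  fixes c :: 'a
  assumes c: "c ^ Suc q = 1"
  shows "card {x. c * x ^ q = x} = q"
proof -
  have c0: "c \<noteq> 0" using c by auto
  \<comment> \<open>Used twice: \<open>e = - 1\<close> bounds the fibres of the map,
    \<open>e = 1\<close> with \<open>y = 0\<close> bounds its image.\<close>
  have bound: "card {x. c * x ^ q + e * x = y} \<le> q" for e y
  proof -
    have "card {x. poly (monom c q + [:- y, e:]) x = 0} \<le> degree (monom c q + [:- y, e:])"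
      using c0 q_gt_1
      by (intro card_poly_roots_bound)
         (auto simp: poly_eq_iff coeff_pCons intro!: exI[of _ q] split: nat.split)
    also have "\<dots> \<le> q"
      using q_gt_1 by (intro degree_add_le degree_monom_le) auto
    finally have "card {x. poly (monom c q + [:- y, e:]) x = 0} \<le> q" .
    moreover have "poly (monom c q + [:- y, e:]) x = 0 \<longleftrightarrow> c * x ^ q + e * x = y" for x
      by (simp add: poly_monom add_diff_eq mult.commute)
    ultimately show ?thesis by (simp only:)
  qed
  have "card {x \<in> UNIV. c * x ^ q + (- 1) * x = 0} = q"
  proof (rule card_fibre_eq_of_bounds[where m = q])
    show "card (UNIV :: 'a set) = q * q"
      by (simp add: card_field power2_eq_square)
    have "c * (c * x ^ q + (- 1) * x) ^ q + 1 * (c * x ^ q + (- 1) * x) = 0" for x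
    proof -
      have "c * (c * x ^ q - x) ^ q = (c * c ^ q) * (x ^ q) ^ q - c * x ^ q"
        by (simp add: diff_power_q power_mult_distrib algebra_simps)
      also have "\<dots> = x - c * x ^ q"
        using c by (simp add: power_q_power_q)
      finally show ?thesis by simp
    qed
    then have "card (range (\<lambda>x. c * x ^ q + (- 1) * x)) \<le> card {x. c * x ^ q + 1 * x = 0}"
      by (intro card_mono) auto
    then show "card (range (\<lambda>x. c * x ^ q + (- 1) * x)) \<le> q"
      using bound[of 1 0] by (rule le_trans)
    show "0 \<in> range (\<lambda>x. c * x ^ q + (- 1) * x)"
      using q_gt_1 by (auto intro!: image_eqI[of _ _ 0])
    show "card {x \<in> UNIV. c * x ^ q + (- 1) * x = y} \<le> q" for y
      using bound[of "- 1" y] by simp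
  qed simp
  then show ?thesis by simp
qed

subsection \<open>Counting self-dual polynomials\<close>


lemma coeff_conj_poly: "coeff (conj_poly q f) i = coeff f i ^ q" for f :: "'a poly"
  using q_gt_1 by (simp add: conj_poly_def coeff_map_poly)

lemma degree_conj_poly: "degree (conj_poly q f) = degree f" for f :: "'a poly"
  unfolding conj_poly_def by (intro degree_map_poly) simp

lemma conj_poly_mult: "conj_poly q (f * g) = conj_poly q f * conj_poly q g" for f g :: "'a poly"
  by (intro poly_eqI) (simp add: coeff_conj_poly coeff_mult sum_power_q power_mult_distrib)

lemma coeff_dual_poly:
  "coeff (dual_poly q f) i
     = (if i > degree f then 0 else inverse (coeff f 0 ^ q) * coeff f (degree f - i) ^ q)"
  for f :: "'a poly"
  by (simp add: dual_poly_def coeff_reflect_poly degree_conj_poly coeff_conj_poly)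

lemma dual_poly_mult: "dual_poly q (f * g) = dual_poly q f * dual_poly q g" for f g :: "'a poly"
  by (simp add: dual_poly_def conj_poly_mult reflect_poly_mult coeff_mult power_mult_distrib
      mult.commute)

lemma degree_dual_poly: "coeff f 0 \<noteq> 0 \<Longrightarrow> degree (dual_poly q f) = degree f" for f :: "'a poly"
  by (simp add: dual_poly_def degree_conj_poly coeff_conj_poly)

lemma lead_coeff_dual_poly: "coeff f 0 \<noteq> 0 \<Longrightarrow> lead_coeff (dual_poly q f) = 1" for f :: "'a poly"
  by (simp add: degree_dual_poly coeff_dual_poly)

lemma coeff_0_dual_poly: "coeff f 0 \<noteq> 0 \<Longrightarrow> coeff (dual_poly q f) 0 \<noteq> 0" for f :: "'a poly"
  by (auto simp: coeff_dual_poly)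

text \<open>Conjugating twice is the identity since \<open>x ^ (q ^ 2) = x\<close>. The scalar
  factors cancel because the dual of a monic \<open>f\<close> has constant term
  \<open>inverse (coeff f 0 ^ q)\<close>.\<close>

lemma dual_poly_dual_poly:
  fixes f :: "'a poly"
  assumes "lead_coeff f = 1" and "coeff f 0 \<noteq> 0"
  shows "dual_poly q (dual_poly q f) = f"
  using assms
  by (intro poly_eqI)
     (auto simp: coeff_dual_poly degree_dual_poly power_mult_distrib power_inverse power_q_power_q
        coeff_eq_0)

text \<open>For constant term 0 the convention \<open>inverse 0 = 0\<close> makes the dual the zero
  polynomial, which is not monic.\<close>

lemma self_dual_coeff_0:
  "lead_coeff f = 1 \<Longrightarrow> self_dual q f \<Longrightarrow> coeff f 0 \<noteq> 0" for f :: "'a poly"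
  using q_gt_1 by (auto simp: self_dual_def dual_poly_def power_0_left)

text \<open>Duality is multiplicative and involutive, so a factorization of the dual yields one of
  \<open>f\<close>. It preserves degrees when the constant term is nonzero, so units are recognized
  by their duals.\<close>

lemma irreducible_dual_poly:
  fixes f :: "'a poly"
  assumes "lead_coeff f = 1" and "coeff f 0 \<noteq> 0" and "irreducible f"
  shows "irreducible (dual_poly q f)"
proof (rule irreducibleI)
  have "degree f > 0"
    using assms(3) by (metis gr0I irreducible_def is_unit_iff_degree)
  then show "\<not> dual_poly q f dvd 1"
    using degree_dual_poly[OF assms(2)]
    by (metis is_unit_iff_degree degree_0 less_irrefl)
  show "dual_poly q f \<noteq> 0"
    using coeff_0_dual_poly[OF assms(2)] by auto
  fix g h assume gh: "dual_poly q f = g * h"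
  have 0: "coeff g 0 \<noteq> 0" "coeff h 0 \<noteq> 0"
    using coeff_0_dual_poly[OF assms(2)] by (auto simp: gh coeff_mult)
  have "f = dual_poly q g * dual_poly q h"
    using dual_poly_dual_poly[OF assms(1,2)] by (simp add: gh dual_poly_mult)
  then have "is_unit (dual_poly q g) \<or> is_unit (dual_poly q h)"
    using assms(3) irreducibleD by blast
  moreover have "is_unit p" if "is_unit (dual_poly q p)" "coeff p 0 \<noteq> 0" for p :: "'a poly"
    using that degree_dual_poly[of p] by (metis coeff_0 is_unit_iff_degree not_is_unit_0)
  ultimately show "is_unit g \<or> is_unit h"
    using 0 by blast
qed

text \<open>
  For \<open>c c\<^sup>q = 1\<close>, the self-dual monic polynomials with constant term \<open>c\<close> are the members of
  \<open>hermitian_polys c n\<close> with constant term \<open>c\<close>. Stripping the two outer coefficients leaves a member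
  of \<open>hermitian_polys c (n - 2)\<close>, with no condition on its constant term.
\<close>

definition hermitian_polys :: "'a \<Rightarrow> nat \<Rightarrow> 'a poly set" where
  "hermitian_polys c n = {f. degree f \<le> n \<and> (\<forall>i\<le>n. coeff f (n - i) = c * coeff f i ^ q)}"

lemma hermitian_polys_0: "hermitian_polys c 0 = (\<lambda>x. [:x:]) ` {x. c * x ^ q = x}"
  by (force simp: hermitian_polys_def elim: degree_eq_zeroE)

lemma degree_le_1_eq: "degree f \<le> Suc 0 \<Longrightarrow> f = [:coeff f 0, coeff f (Suc 0):]" for f :: "'a poly"
  by (intro poly_eqI) (auto simp: coeff_pCons coeff_eq_0 split: nat.split)

text \<open>The condition at \<open>i = 0\<close> determines the linear coefficient; the one at
  \<open>i = 1\<close> then follows from the norm of \<open>c\<close>.\<close>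

lemma hermitian_polys_1:
  assumes "c ^ Suc q = 1"
  shows "hermitian_polys c 1 = (\<lambda>a. [:a, c * a ^ q:]) ` UNIV"
proof (intro equalityI subsetI)
  fix f assume "f \<in> hermitian_polys c 1"
  then have deg: "degree f \<le> Suc 0" and eq: "coeff f (Suc 0) = c * coeff f 0 ^ q"
    by (auto simp: hermitian_polys_def)
  from degree_le_1_eq[OF deg] show "f \<in> (\<lambda>a. [:a, c * a ^ q:]) ` UNIV"
    unfolding eq by (rule range_eqI)
next
  fix f assume "f \<in> (\<lambda>a. [:a, c * a ^ q:]) ` UNIV"
  then obtain a where a: "f = [:a, c * a ^ q:]" by blast
  have "c * (c * a ^ q) ^ q = a"
    using assms by (simp add: power_mult_distrib power_q_power_q flip: mult.assoc)
  then show "f \<in> hermitian_polys c 1"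
    by (auto simp: hermitian_polys_def a le_Suc_eq)
qed

text \<open>The constant term \<open>a\<close> forces the top coefficient \<open>c * a ^ q\<close>;
  the inner coefficients satisfy the same symmetry for the bound \<open>n\<close>.\<close>

lemma card_hermitian_polys_fibre:
  assumes c: "c ^ Suc q = 1"
  shows "card {f \<in> hermitian_polys c (Suc (Suc n)). coeff f 0 = a} = card (hermitian_polys c n)"
proof (rule sym, rule bij_betw_same_card, rule bij_betwI)
  \<comment> \<open>\<open>?F\<close> attaches the outer coefficients and \<open>?G\<close> strips
    them; after the shift the old top coefficient sits at index \<open>Suc n\<close>.\<close>
  let ?F = "\<lambda>h. pCons a h + monom (c * a ^ q) (Suc (Suc n))"
  let ?G = "\<lambda>f. poly_shift 1 f - monom (coeff f (Suc (Suc n))) (Suc n)"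
  have ca: "c * (c * a ^ q) ^ q = a"
    using c by (simp add: power_mult_distrib power_q_power_q flip: mult.assoc)
  show "?F \<in> hermitian_polys c n \<rightarrow> {f \<in> hermitian_polys c (Suc (Suc n)). coeff f 0 = a}"
  proof
    fix h assume h: "h \<in> hermitian_polys c n"
    then have deg: "degree h \<le> n" by (simp add: hermitian_polys_def)
    have "degree (pCons a h) \<le> Suc (Suc n)"
      using deg degree_pCons_le[of a h] by linarith
    then have "degree (?F h) \<le> Suc (Suc n)"
      by (intro degree_add_le degree_monom_le)
    moreover have "coeff (?F h) (Suc (Suc n) - i) = c * coeff (?F h) i ^ q" if i: "i \<le> Suc (Suc n)" for i
    proof (cases "i = 0 \<or> i = Suc (Suc n)")
      case True
      then show ?thesis
        using deg ca by (auto simp: coeff_eq_0)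
    next
      case False
      then obtain j where j: "i = Suc j" "j \<le> n"
        using i by (cases i) auto
      then have "coeff (?F h) (Suc (Suc n) - i) = coeff h (n - j)"
        by (auto simp: Suc_diff_le)
      also have "\<dots> = c * coeff h j ^ q"
        using h j by (simp add: hermitian_polys_def)
      finally show ?thesis
        using j by auto
    qed
    ultimately show "?F h \<in> {f \<in> hermitian_polys c (Suc (Suc n)). coeff f 0 = a}"
      by (auto simp: hermitian_polys_def)
  qed
  show "?G \<in> {f \<in> hermitian_polys c (Suc (Suc n)). coeff f 0 = a} \<rightarrow> hermitian_polys c n"
  proof
    fix f assume "f \<in> {f \<in> hermitian_polys c (Suc (Suc n)). coeff f 0 = a}"
    then have f: "degree f \<le> Suc (Suc n)"
      "\<And>i. i \<le> Suc (Suc n) \<Longrightarrow> coeff f (Suc (Suc n) - i) = c * coeff f i ^ q"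
      by (auto simp: hermitian_polys_def)
    have "degree (?G f) \<le> n"
      using f(1) by (intro degree_le) (auto simp: coeff_poly_shift coeff_eq_0)
    moreover have "coeff (?G f) (n - i) = c * coeff (?G f) i ^ q" if "i \<le> n" for i
      using f(2)[of "Suc i"] that by (auto simp: coeff_poly_shift Suc_diff_le)
    ultimately show "?G f \<in> hermitian_polys c n"
      by (simp add: hermitian_polys_def)
  qed
  show "?G (?F h) = h" if "h \<in> hermitian_polys c n" for h
    using that by (intro poly_eqI) (auto simp: coeff_poly_shift hermitian_polys_def coeff_eq_0)
  show "?F (?G f) = f" if "f \<in> {f \<in> hermitian_polys c (Suc (Suc n)). coeff f 0 = a}" for f
  proof -
    have "coeff f (Suc (Suc n)) = c * coeff f 0 ^ q" "coeff f 0 = a"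
      using that by (auto simp: hermitian_polys_def dest!: spec[of _ 0])
    then show ?thesis
      by (intro poly_eqI) (auto simp: coeff_poly_shift coeff_pCons split: nat.split)
  qed
qed

text \<open>Induction in steps of two. The base cases are the twisted fixed points and the free
  choice of one coefficient; each step multiplies by the \<open>q ^ 2\<close> choices of the
  constant term.\<close>

lemma card_hermitian_polys:
  assumes c: "c ^ Suc q = 1"
  shows "card (hermitian_polys c n) = q ^ Suc n"
proof (induction n rule: induct_nat_012)
  case 0
  then show ?case
    using card_twisted_fixed_points[OF c] by (simp add: hermitian_polys_0 card_image inj_on_def)
next
  case 1
  then show ?case
    using hermitian_polys_1[OF c] by (simp add: card_image inj_on_def card_field power2_eq_square)
next
  case (ge2 n)
  let ?H = "hermitian_polys c (Suc (Suc n))"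
  have *: "card {f \<in> ?H. coeff f 0 = a} = q ^ Suc n" for a
    using card_hermitian_polys_fibre[OF c] ge2 by simp
  have "finite {f \<in> ?H. coeff f 0 = a}" for a
    using *[of a] q_gt_1 by (intro card_ge_0_finite) simp
  then have "card (\<Union>a\<in>UNIV. {f \<in> ?H. coeff f 0 = a}) = (\<Sum>a\<in>UNIV. card {f \<in> ?H. coeff f 0 = a})"
    by (intro card_UN_disjoint) auto
  also have "\<dots> = q ^ Suc (Suc (Suc n))"
    unfolding * by (simp add: card_field power2_eq_square)
  also have "(\<Union>a\<in>UNIV. {f \<in> ?H. coeff f 0 = a}) = ?H"
    by auto
  finally show ?case .
qed

definition self_dual_monics :: "nat \<Rightarrow> 'a poly set" where
  "self_dual_monics n = {f. lead_coeff f = 1 \<and> degree f = n \<and> self_dual q f}"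

lemma self_dual_monics_0: "self_dual_monics 0 = {1}"
proof -
  have "self_dual q (1 :: 'a poly)"
    by (simp add: self_dual_def dual_poly_def conj_poly_def)
  then show ?thesis
    by (auto simp: self_dual_monics_def one_pCons elim: degree_eq_zeroE)
qed

text \<open>Comparing constant terms in \<open>dual_poly q f = f\<close> gives
  \<open>inverse (c ^ q) = c\<close>, that is, norm 1, and self-duality becomes the Hermitian
  symmetry. Conversely, the symmetry at \<open>i = 0\<close> with norm 1 makes the polynomial
  monic.\<close>

lemma self_dual_monics_eq_UN:
  assumes "n > 0"
  shows "self_dual_monics n = (\<Union>c\<in>{c. c ^ Suc q = 1}. {f \<in> hermitian_polys c n. coeff f 0 = c})"
proof (intro equalityI subsetI)
  fix f assume "f \<in> self_dual_monics n"
  then have f: "lead_coeff f = 1" "degree f = n" "dual_poly q f = f" "coeff f 0 \<noteq> 0"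
    using self_dual_coeff_0 by (auto simp: self_dual_monics_def self_dual_def)
  have *: "coeff f i = inverse (coeff f 0 ^ q) * coeff f (n - i) ^ q" if "i \<le> n" for i
    using coeff_dual_poly[of f i] f that by simp
  from *[of 0] f have inv: "inverse (coeff f 0 ^ q) = coeff f 0" by simp
  then have "coeff f 0 ^ Suc q = 1"
    using f(4) by (metis power_Suc left_inverse power_not_zero)
  moreover have "coeff f (n - i) = coeff f 0 * coeff f i ^ q" if "i \<le> n" for i
    using *[of "n - i"] that by (simp add: inv)
  then have "f \<in> hermitian_polys (coeff f 0) n"
    using f(2) by (simp add: hermitian_polys_def)
  ultimately show "f \<in> (\<Union>c\<in>{c. c ^ Suc q = 1}. {f \<in> hermitian_polys c n. coeff f 0 = c})"
    by auto
next
  fix f assume "f \<in> (\<Union>c\<in>{c. c ^ Suc q = 1}. {f \<in> hermitian_polys c n. coeff f 0 = c})"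
  then have c: "coeff f 0 ^ Suc q = 1" and deg: "degree f \<le> n"
    and *: "\<And>i. i \<le> n \<Longrightarrow> coeff f (n - i) = coeff f 0 * coeff f i ^ q"
    by (auto simp: hermitian_polys_def)
  have "coeff f n = 1" using *[of 0] c by simp
  then have n: "degree f = n"
    using deg le_degree[of f n] by simp
  have inv: "inverse (coeff f 0 ^ q) = coeff f 0"
    using c by (metis inverse_unique mult.commute power_Suc)
  have "dual_poly q f = f"
  proof (rule poly_eqI)
    show "coeff (dual_poly q f) i = coeff f i" for i
      using *[of "n - i"] n by (cases "i \<le> n") (simp_all add: coeff_dual_poly inv coeff_eq_0)
  qed
  then show "f \<in> self_dual_monics n"
    using n \<open>coeff f n = 1\<close> by (simp add: self_dual_monics_def self_dual_def)
qed

text \<open>There are \<open>q + 1\<close> constant terms of norm 1. In degree 1 the constant term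
  determines the polynomial; in higher degree the inner coefficients form a Hermitian polynomial for
  the bound \<open>n - 1\<close>, with \<open>q ^ n\<close> choices.\<close>

lemma card_self_dual_monics: "card (self_dual_monics (Suc n)) = Suc q * q ^ n"
proof -
  have card: "card {f \<in> hermitian_polys c (Suc n). coeff f 0 = c} = q ^ n" if c: "c ^ Suc q = 1" for c
  proof (cases n)
    case 0
    have "{f \<in> hermitian_polys c 1. coeff f 0 = c} = {[:c, c * c ^ q:]}"
    proof (intro equalityI subsetI)
      fix f assume "f \<in> {f \<in> hermitian_polys c 1. coeff f 0 = c}"
      then obtain a where "f = [:a, c * a ^ q:]" "coeff f 0 = c"
        unfolding hermitian_polys_1[OF c] by blast
      then show "f \<in> {[:c, c * c ^ q:]}" by simp
    next
      fix f assume "f \<in> {[:c, c * c ^ q:]}"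
      then show "f \<in> {f \<in> hermitian_polys c 1. coeff f 0 = c}"
        unfolding hermitian_polys_1[OF c] by auto
    qed
    then show ?thesis by (simp add: 0)
  next
    case (Suc m)
    then show ?thesis
      using card_hermitian_polys_fibre[OF c] card_hermitian_polys[OF c] by simp
  qed
  have "finite {f \<in> hermitian_polys c (Suc n). coeff f 0 = c}" if "c ^ Suc q = 1" for c
    using card[OF that] q_gt_1 by (intro card_ge_0_finite) simp
  then have "card (self_dual_monics (Suc n))
      = (\<Sum>c | c ^ Suc q = 1. card {f \<in> hermitian_polys c (Suc n). coeff f 0 = c})"
    unfolding self_dual_monics_eq_UN[OF zero_less_Suc] by (intro card_UN_disjoint) auto
  also have "\<dots> = (\<Sum>c\<in>{c::'a. c ^ Suc q = 1}. q ^ n)"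
    using card by (intro sum.cong) auto
  finally show ?thesis
    using card_norm_one by simp
qed

text \<open>Serves to divide an orbit product out of a self-dual polynomial.\<close>

lemma self_dual_monics_mult_cancel:
  assumes "f * g \<in> self_dual_monics n" and "f \<in> self_dual_monics k"
  shows "g \<in> self_dual_monics (n - k)"
proof -
  have f: "f \<noteq> 0" "dual_poly q f = f" "lead_coeff f = 1" "degree f = k"
    using assms(2) by (auto simp: self_dual_monics_def self_dual_def)
  have fg: "dual_poly q (f * g) = f * g" "lead_coeff (f * g) = 1" "degree (f * g) = n"
    using assms(1) by (auto simp: self_dual_monics_def self_dual_def)
  have "g \<noteq> 0" using fg by auto
  have "f * dual_poly q g = f * g"
    using fg f by (simp add: dual_poly_mult)
  then have "dual_poly q g = g" using f by simp
  moreover have "lead_coeff g = 1"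
    using fg(2) f(3) by (simp add: lead_coeff_mult)
  moreover have "degree g = n - k"
    using fg(3) f \<open>g \<noteq> 0\<close> by (auto simp: degree_mult_eq)
  ultimately show ?thesis
    by (simp add: self_dual_monics_def self_dual_def)
qed

lemma self_dual_monics_mult:
  assumes "f \<in> self_dual_monics n" and "g \<in> self_dual_monics k"
  shows "f * g \<in> self_dual_monics (n + k)"
proof -
  have "f \<noteq> 0" "g \<noteq> 0" using assms by (auto simp: self_dual_monics_def)
  then have "degree (f * g) = n + k"
    using assms by (simp add: degree_mult_eq self_dual_monics_def)
  moreover have "lead_coeff (f * g) = 1"
    unfolding lead_coeff_mult using assms by (auto simp: self_dual_monics_def)
  moreover have "dual_poly q (f * g) = f * g"
    using assms by (simp add: dual_poly_mult self_dual_monics_def self_dual_def)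
  ultimately show ?thesis
    by (simp add: self_dual_monics_def self_dual_def)
qed

end

subsection \<open>Factorization of self-dual polynomials into orbits\<close>

lemma finite_degree_le: "finite {f :: 'a::{zero,finite} poly. degree f \<le> n}"
proof -
  have "{f :: 'a poly. degree f \<le> n} \<subseteq> Poly ` {xs. set xs \<subseteq> UNIV \<and> length xs \<le> Suc n}"
  proof
    fix f :: "'a poly" assume "f \<in> {f. degree f \<le> n}"
    then have "length (coeffs f) \<le> Suc n"
      by (cases "f = 0") (auto simp: length_coeffs_degree)
    then show "f \<in> Poly ` {xs. set xs \<subseteq> UNIV \<and> length xs \<le> Suc n}"
      by (intro image_eqI[of _ _ "coeffs f"]) auto
  qed
  then show ?thesis
    by (rule finite_subset) (intro finite_imageI finite_lists_length_le finite)
qed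

lemma monic_irreducible_divisor_exists:
  fixes f :: "'a::field poly"
  assumes "degree f > 0"
  shows "\<exists>g. g dvd f \<and> lead_coeff g = 1 \<and> irreducible g"
  using assms
proof (induction "degree f" arbitrary: f rule: less_induct)
  case less
  then have "f \<noteq> 0" by auto
  show ?case
  proof (cases "irreducible f")
    case True
    let ?c = "inverse (lead_coeff f)"
    have c: "?c \<noteq> 0" using \<open>f \<noteq> 0\<close> by simp
    have "smult ?c f dvd f" using c by (simp add: smult_dvd_iff)
    moreover have "lead_coeff (smult ?c f) = 1" using \<open>f \<noteq> 0\<close> by simp
    moreover have "irreducible (smult ?c f)"
      using irreducible_mult_unit_left[of "[:?c:]" f] True is_unit_triv[OF c] by simp
    ultimately show ?thesis by blast
  next
    case False
    moreover have "\<not> is_unit f"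
      using less.prems \<open>f \<noteq> 0\<close> by (simp add: is_unit_iff_degree)
    ultimately obtain g h where gh: "f = g * h" "\<not> is_unit g" "\<not> is_unit h"
      using \<open>f \<noteq> 0\<close> by (auto simp: irreducible_def)
    with \<open>f \<noteq> 0\<close> have "g \<noteq> 0" "h \<noteq> 0" by auto
    with gh have "degree g > 0" "degree h > 0"
      by (auto simp: is_unit_iff_degree)
    with gh(1) \<open>g \<noteq> 0\<close> \<open>h \<noteq> 0\<close> have "degree g < degree f"
      by (simp add: degree_mult_eq)
    then show ?thesis
      using less.hyps \<open>degree g > 0\<close> gh(1) by (meson dvd_mult2)
  qed
qed

lemma monic_irreducible_dvd_imp_eq:
  fixes g h :: "'a::field poly"
  assumes "irreducible g" "lead_coeff g = 1" "irreducible h" "lead_coeff h = 1" "g dvd h"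
  shows "g = h"
proof -
  from assms(5) obtain k where k: "h = g * k" by blast
  with assms(1,3) have "is_unit k"
    using irreducibleD irreducible_not_unit by blast
  then obtain a where "k = [:a:]"
    using is_unit_poly_iff by blast
  moreover from this have "a = 1"
    using assms(2,4) k by (metis degree_pCons_0 coeff_pCons_0 lead_coeff_mult mult_1)
  ultimately show ?thesis using k by simp
qed

context quadratic_field
begin

section \<open>Orbits of monic irreducibles under duality\<close>

lemma dual_poly_in_monic_irreducibles:
  "f \<in> monic_irreducibles d \<Longrightarrow> dual_poly q f \<in> monic_irreducibles d" for f :: "'a poly"
  using lead_coeff_dual_poly[of f]
  by (auto simp: monic_irreducibles_def irreducible_dual_poly degree_dual_poly coeff_0_dual_poly)

lemma dual_dual_monic_irreducible:
  "f \<in> monic_irreducibles d \<Longrightarrow> dual_poly q (dual_poly q f) = f" for f :: "'a poly"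
  by (auto simp: monic_irreducibles_def dual_poly_dual_poly)

lemma monic_irreducible_degree_pos: "f \<in> monic_irreducibles d \<Longrightarrow> d > 0" for f :: "'a poly"
  by (auto simp: monic_irreducibles_def irreducible_def is_unit_iff_degree intro!: gr0I)

text \<open>The pair collapses to \<open>{f}\<close> here; the shape shared with
  \<open>free_orbits\<close> lets \<open>\<Prod>P\<close> be \<open>f\<close> in one case and
  \<open>f * dual_poly q f\<close> in the other.\<close>

definition fixed_orbits :: "nat \<Rightarrow> 'a poly set set" where
  "fixed_orbits d = {{f, dual_poly q f} | f. f \<in> monic_irreducibles d \<and> self_dual q f}"

definition free_orbits :: "nat \<Rightarrow> 'a poly set set" where
  "free_orbits d = {{f, dual_poly q f} | f. f \<in> monic_irreducibles d \<and> \<not> self_dual q f}"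

text \<open>The degree bound keeps the set finite, so that a product of power series over it makes
  sense.\<close>

definition orbits :: "nat \<Rightarrow> 'a poly set set" where
  "orbits N = (\<Union>d\<in>{1..N}. fixed_orbits d) \<union> (\<Union>d\<in>{1..N}. free_orbits d)"

lemma card_fixed_orbits: "card (fixed_orbits d) = SDIM_minus TYPE('a) q d"
proof -
  have "fixed_orbits d = (\<lambda>f. {f}) ` {f. f \<in> monic_irreducibles d \<and> self_dual q f}"
    by (auto simp: fixed_orbits_def self_dual_def)
  then show ?thesis
    by (simp add: SDIM_minus_def card_image)
qed

lemma card_free_orbits: "card (free_orbits d) = SDIM_plus TYPE('a) q d"
  by (simp add: free_orbits_def SDIM_plus_def)

lemma finite_orbits: "finite (fixed_orbits d)" "finite (free_orbits d)" "finite (orbits N)"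
proof -
  have "monic_irreducibles d \<subseteq> {f :: 'a poly. degree f \<le> d}" for d
    by (auto simp: monic_irreducibles_def)
  then have fin: "finite (monic_irreducibles d :: 'a poly set)" for d
    using finite_degree_le finite_subset by blast
  have *: "finite (fixed_orbits d)" "finite (free_orbits d)" for d
    by (rule finite_surj[OF fin[of d], of _ "\<lambda>f. {f, dual_poly q f}"],
        auto simp: fixed_orbits_def free_orbits_def)+
  then show "finite (fixed_orbits d)" "finite (free_orbits d)" by auto
  show "finite (orbits N)" using * by (simp add: orbits_def)
qed

lemma orbits_iff:
  "P \<in> orbits N \<longleftrightarrow> (\<exists>d\<le>N. \<exists>f \<in> monic_irreducibles d. P = {f, dual_poly q f})"
proof
  assume "P \<in> orbits N"
  then show "\<exists>d\<le>N. \<exists>f \<in> monic_irreducibles d. P = {f, dual_poly q f}"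
    by (auto simp: orbits_def fixed_orbits_def free_orbits_def)
next
  assume "\<exists>d\<le>N. \<exists>f \<in> monic_irreducibles d. P = {f, dual_poly q f}"
  then obtain d f where df: "d \<le> N" "f \<in> monic_irreducibles d" "P = {f, dual_poly q f}"
    by blast
  then have "d \<in> {1..N}"
    using monic_irreducible_degree_pos by force
  moreover have "P \<in> fixed_orbits d \<or> P \<in> free_orbits d"
    using df by (auto simp: fixed_orbits_def free_orbits_def)
  ultimately show "P \<in> orbits N"
    unfolding orbits_def by blast
qed

lemma prod_fixed_orbit:
  assumes "P \<in> fixed_orbits d"
  shows "\<Prod>P \<in> self_dual_monics d"
  using assms by (auto simp: fixed_orbits_def self_dual_monics_def self_dual_def monic_irreducibles_def)

lemma prod_free_orbit:
  assumes "P \<in> free_orbits d"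
  shows "\<Prod>P \<in> self_dual_monics (2 * d)"
proof -
  from assms obtain f where f: "f \<in> monic_irreducibles d" "f \<noteq> dual_poly q f" "P = {f, dual_poly q f}"
    by (auto simp: free_orbits_def self_dual_def)
  note dual = dual_poly_in_monic_irreducibles[OF f(1)] dual_dual_monic_irreducible[OF f(1)]
  have P: "\<Prod>P = f * dual_poly q f" using f by simp
  have "f \<noteq> 0" "dual_poly q f \<noteq> 0"
    using f(1) dual(1) by (auto simp: monic_irreducibles_def)
  then have "degree (\<Prod>P) = 2 * d"
    using f(1) dual(1) by (simp add: P degree_mult_eq monic_irreducibles_def)
  moreover have "lead_coeff (\<Prod>P) = 1"
    unfolding P lead_coeff_mult using f(1) dual(1) by (auto simp: monic_irreducibles_def)
  moreover have "self_dual q (\<Prod>P)"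
    by (simp add: self_dual_def P dual_poly_mult dual mult.commute)
  ultimately show ?thesis
    by (simp add: self_dual_monics_def)
qed

lemma prod_orbit:
  assumes "P \<in> orbits N"
  shows "\<Prod>P \<in> self_dual_monics (degree (\<Prod>P))" and "degree (\<Prod>P) > 0"
proof -
  from assms obtain d where d: "d \<in> {1..N}" "P \<in> fixed_orbits d \<or> P \<in> free_orbits d"
    unfolding orbits_def by blast
  define k where "k = (if P \<in> fixed_orbits d then d else 2 * d)"
  have "\<Prod>P \<in> self_dual_monics k" "k > 0"
    using d prod_fixed_orbit prod_free_orbit by (auto simp: k_def)
  moreover from this have "degree (\<Prod>P) = k"
    by (simp add: self_dual_monics_def)
  ultimately show "\<Prod>P \<in> self_dual_monics (degree (\<Prod>P))" "degree (\<Prod>P) > 0"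
    by simp_all
qed

text \<open>An irreducible \<open>g\<close> is prime, so it divides an element of \<open>P\<close>
  and, all being monic irreducible, equals it. As duality is an involution, either element generates
  \<open>P\<close>.\<close>

lemma orbit_eq_of_dvd:
  assumes "P \<in> orbits N" and g: "g \<in> monic_irreducibles k" and "g dvd \<Prod>P"
  shows "P = {g, dual_poly q g}"
proof -
  from assms(1) obtain d f where f: "f \<in> monic_irreducibles d" "P = {f, dual_poly q f}"
    by (auto simp: orbits_iff)
  have "prime_elem g"
    using g by (simp add: monic_irreducibles_def field_poly_irreducible_imp_prime)
  \<comment> \<open>Only divisibility: for a self-dual \<open>f\<close> the product over the set is
    \<open>f\<close> itself.\<close>
  moreover have "\<Prod>P dvd f * dual_poly q f"
    using f(2) by (cases "f = dual_poly q f") auto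
  ultimately obtain h where h: "h \<in> P" "g dvd h"
    using assms(3) f(2) prime_elem_dvd_mult_iff[of g f] by (meson dvd_trans insertCI)
  have "h \<in> monic_irreducibles d"
    using h f dual_poly_in_monic_irreducibles by auto
  then have "g = h"
    using g h(2) monic_irreducible_dvd_imp_eq[of g h] by (auto simp: monic_irreducibles_def)
  then show ?thesis
    using h(1) f dual_dual_monic_irreducible by auto
qed

text \<open>A generator of an orbit \<open>P\<close> in \<open>M\<close> divides some orbit product
  of \<open>M'\<close>, and that orbit must be \<open>P\<close>; cancel it and induct.\<close>

lemma orbit_multiset_unique:
  assumes "set_mset M \<subseteq> orbits N" "set_mset M' \<subseteq> orbits N'"
    and "(\<Prod>P\<in>#M. \<Prod>P) = (\<Prod>P\<in>#M'. \<Prod>P)"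
  shows "M = M'"
  using assms
proof (induction M arbitrary: M')
  case empty
  have "M' = {#}"
  proof (rule ccontr)
    assume "M' \<noteq> {#}"
    then obtain P where "P \<in># M'" by blast
    then have "\<Prod>P dvd (\<Prod>P\<in>#M'. \<Prod>P)"
      by (intro dvd_prod_mset) auto
    then have "is_unit (\<Prod>P)" using empty.prems by simp
    moreover have "degree (\<Prod>P) > 0"
      using \<open>P \<in># M'\<close> empty.prems(2) prod_orbit(2) by blast
    ultimately show False
      by (metis is_unit_iff_degree degree_0 less_irrefl)
  qed
  then show ?case by simp
next
  case (add P M)
  from add.prems(1) have "P \<in> orbits N" by simp
  then obtain d g where g: "g \<in> monic_irreducibles d" "P = {g, dual_poly q g}"
    by (auto simp: orbits_iff)
  have "prime_elem g"
    using g by (simp add: monic_irreducibles_def field_poly_irreducible_imp_prime)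
  have "g dvd \<Prod>P" using g(2) by (intro dvd_prodI) auto
  then have "g dvd (\<Prod>P\<in>#M'. \<Prod>P)"
    using add.prems(3) by (metis dvd_mult2 image_mset_add_mset prod_mset.add_mset)
  then obtain h where "h \<in># image_mset (\<lambda>P. \<Prod>P) M'" "g dvd h"
    by (rule prime_elem_dvd_prod_msetE[OF \<open>prime_elem g\<close>])
  then obtain P' where P': "P' \<in># M'" "g dvd \<Prod>P'"
    by auto
  then have "P' = P"
    using orbit_eq_of_dvd[of P' N'] add.prems(2) g by auto
  with P' obtain M'' where M'': "M' = add_mset P M''"
    by (auto dest: multi_member_split)
  have "\<Prod>P \<noteq> 0"
    using prod_orbit(2)[OF \<open>P \<in> orbits N\<close>] by auto
  then have "(\<Prod>P\<in>#M. \<Prod>P) = (\<Prod>P\<in>#M''. \<Prod>P)"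
    using add.prems(3) by (simp add: M'')
  with add.IH[of M''] add.prems(1,2) show ?case
    by (simp add: M'')
qed

text \<open>Strong induction on the degree: a monic irreducible divisor of \<open>f\<close> brings
  its dual along, so the orbit product divides \<open>f\<close>, and the quotient is again
  self-dual.\<close>

lemma orbit_multiset_exists:
  assumes "f \<in> self_dual_monics n" and "n \<le> N"
  shows "\<exists>M. set_mset M \<subseteq> orbits N \<and> f = (\<Prod>P\<in>#M. \<Prod>P)"
  using assms
proof (induction n arbitrary: f rule: less_induct)
  case (less n)
  show ?case
  proof (cases "n = 0")
    case True
    with less.prems have "f = 1" by (simp add: self_dual_monics_0)
    then show ?thesis by (intro exI[of _ "{#}"]) simp
  next
    case False
    from less.prems have f: "lead_coeff f = 1" "degree f = n" "dual_poly q f = f" "coeff f 0 \<noteq> 0"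
      using self_dual_coeff_0 by (auto simp: self_dual_monics_def self_dual_def)
    then obtain g where g: "g dvd f" "lead_coeff g = 1" "irreducible g"
      using monic_irreducible_divisor_exists[of f] False by auto
    have "coeff g 0 \<noteq> 0"
      using g(1) f(4) by (auto simp: coeff_mult elim!: dvdE)
    with g have gmi: "g \<in> monic_irreducibles (degree g)"
      by (simp add: monic_irreducibles_def)
    have "f \<noteq> 0" using f by auto
    then have "degree g \<le> n"
      using g(1) f(2) dvd_imp_degree_le by blast
    let ?P = "{g, dual_poly q g}"
    have P: "?P \<in> orbits N"
      using gmi \<open>degree g \<le> n\<close> less.prems(2) orbits_iff le_trans by blast
    have "\<Prod>?P dvd f"
    proof (cases "dual_poly q g = g")
      case True
      then show ?thesis using g by simp
    next
      case False
      have dg: "dual_poly q g \<in> monic_irreducibles (degree g)"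
        using gmi by (rule dual_poly_in_monic_irreducibles)
      from g(1) obtain h where h: "f = g * h" by blast
      have "dual_poly q g dvd f"
        using f(3) h by (metis dual_poly_mult dvd_triv_left)
      \<comment> \<open>Two different monic irreducibles do not divide each other, so the dual must
        divide the cofactor \<open>h\<close>.\<close>
      moreover have "\<not> dual_poly q g dvd g"
        using False monic_irreducible_dvd_imp_eq[of "dual_poly q g" g] dg gmi
        by (auto simp: monic_irreducibles_def)
      moreover have "prime_elem (dual_poly q g)"
        using dg by (simp add: monic_irreducibles_def field_poly_irreducible_imp_prime)
      ultimately have "dual_poly q g dvd h"
        using h prime_elem_dvd_mult_iff by blast
      then show ?thesis
        using False h by (simp add: mult_dvd_mono)
    qed
    then obtain h where h: "f = \<Prod>?P * h" by blast
    note P' = prod_orbit[OF P]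
    have "h \<in> self_dual_monics (n - degree (\<Prod>?P))"
      using self_dual_monics_mult_cancel[OF _ P'(1)] less.prems(1) h by blast
    moreover have "n - degree (\<Prod>?P) < n"
      using P'(2) False by simp
    ultimately obtain M where M: "set_mset M \<subseteq> orbits N" "h = (\<Prod>P\<in>#M. \<Prod>P)"
      using less.IH[of "n - degree (\<Prod>?P)" h] less.prems(2) by auto
    show ?thesis
      using M P by (intro exI[of _ "add_mset ?P M"]) (simp add: h)
  qed
qed

lemma prod_mset_orbits:
  assumes "set_mset M \<subseteq> orbits N"
  shows "(\<Prod>P\<in>#M. \<Prod>P) \<in> self_dual_monics (\<Sum>P\<in>#M. degree (\<Prod>P))"
  using assms
proof (induction M)
  case empty
  then show ?case by (simp add: self_dual_monics_0)
next
  case (add P M)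
  then show ?case
    using self_dual_monics_mult[OF prod_orbit(1)[of P N]] by simp
qed

text \<open>Taking products is a bijection by unique factorization into orbits; the bound
  \<open>N\<close> loses nothing since irreducible divisors have degree at most
  \<open>n\<close>.\<close>

lemma card_weighted_multisets_orbits:
  assumes "n \<le> N"
  shows "card (weighted_multisets (orbits N) (\<lambda>P. degree (\<Prod>P)) n) = card (self_dual_monics n)"
proof (rule bij_betw_same_card[of "\<lambda>M. \<Prod>P\<in>#M. \<Prod>P"], rule bij_betw_imageI)
  show "inj_on (\<lambda>M. \<Prod>P\<in>#M. \<Prod>P) (weighted_multisets (orbits N) (\<lambda>P. degree (\<Prod>P)) n)"
    using orbit_multiset_unique by (auto simp: inj_on_def weighted_multisets_def)
  show "(\<lambda>M. \<Prod>P\<in>#M. \<Prod>P) ` weighted_multisets (orbits N) (\<lambda>P. degree (\<Prod>P)) n = self_dual_monics n"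
  proof (intro equalityI subsetI)
    fix f assume "f \<in> (\<lambda>M. \<Prod>P\<in>#M. \<Prod>P) ` weighted_multisets (orbits N) (\<lambda>P. degree (\<Prod>P)) n"
    then show "f \<in> self_dual_monics n"
      using prod_mset_orbits by (auto simp: weighted_multisets_def)
  next
    fix f assume f: "f \<in> self_dual_monics n"
    then obtain M where M: "set_mset M \<subseteq> orbits N" "f = (\<Prod>P\<in>#M. \<Prod>P)"
      using orbit_multiset_exists[OF f assms] by blast
    have "(\<Sum>P\<in>#M. degree (\<Prod>P)) = n"
      using prod_mset_orbits[OF M(1)] f M(2) by (simp add: self_dual_monics_def)
    with M show "f \<in> (\<lambda>M. \<Prod>P\<in>#M. \<Prod>P) ` weighted_multisets (orbits N) (\<lambda>P. degree (\<Prod>P)) n"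
      by (auto simp: weighted_multisets_def)
  qed
qed

section \<open>The generating function of self-dual monic polynomials\<close>

text \<open>Groups the orbits by type and by the degree \<open>d\<close> of their elements; this
  matches the exponents \<open>d\<close> and \<open>2 * d\<close> of the truncated products.\<close>

lemma prod_orbits:
  "(\<Prod>P\<in>orbits N. h (degree (\<Prod>P)))
     = (\<Prod>d=1..N. h d ^ SDIM_minus TYPE('a) q d) * (\<Prod>d=1..N. h (2 * d) ^ SDIM_plus TYPE('a) q d)"
  for h :: "nat \<Rightarrow> 'b::comm_monoid_mult"
proof -
  have deg: "P \<in> fixed_orbits d \<Longrightarrow> degree (\<Prod>P) = d" "P \<in> free_orbits d \<Longrightarrow> degree (\<Prod>P) = 2 * d" for P d
    using prod_fixed_orbit prod_free_orbit by (auto simp: self_dual_monics_def)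
  \<comment> \<open>Keeps fixed and free orbits apart: an orbit equal to a fixed one is a
    singleton.\<close>
  have orbit_self_dual: "dual_poly q f = f" if "{f, dual_poly q f} = {g, dual_poly q g}" "self_dual q g" for f g :: "'a poly"
    using that by (auto simp: self_dual_def)
  have disj: "(\<Union>d\<in>{1..N}. fixed_orbits d) \<inter> (\<Union>d\<in>{1..N}. free_orbits d) = {}"
    using orbit_self_dual by (fastforce simp: fixed_orbits_def free_orbits_def self_dual_def)
  have "(\<Prod>P\<in>orbits N. h (degree (\<Prod>P)))
     = (\<Prod>P\<in>(\<Union>d\<in>{1..N}. fixed_orbits d). h (degree (\<Prod>P))) *
       (\<Prod>P\<in>(\<Union>d\<in>{1..N}. free_orbits d). h (degree (\<Prod>P)))"
    unfolding orbits_def using disj finite_orbits by (intro prod.union_disjoint) auto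
  also have "(\<Prod>P\<in>(\<Union>d\<in>{1..N}. fixed_orbits d). h (degree (\<Prod>P)))
      = (\<Prod>d=1..N. \<Prod>P\<in>fixed_orbits d. h (degree (\<Prod>P)))"
    using deg(1) finite_orbits by (intro prod.UNION_disjoint) blast+
  also have "(\<Prod>P\<in>(\<Union>d\<in>{1..N}. free_orbits d). h (degree (\<Prod>P)))
      = (\<Prod>d=1..N. \<Prod>P\<in>free_orbits d. h (degree (\<Prod>P)))"
    using deg(2) finite_orbits by (intro prod.UNION_disjoint) (auto, metis mult_cancel1 zero_neq_numeral)
  finally show ?thesis
    by (simp add: deg card_fixed_orbits card_free_orbits)
qed

text \<open>Every factor is a geometric series in \<open>x ^ w\<close>, so each multiset of orbits
  is counted with coefficient 1.\<close>

lemma truncated_product_nth: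
  assumes "n \<le> N"
  shows "truncated_product (- 1) (SDIM_minus TYPE('a) q) (SDIM_plus TYPE('a) q) N $ n
     = of_nat (card (self_dual_monics n))"
proof -
  let ?w = "\<lambda>P :: 'a poly set. degree (\<Prod>P)"
  have factor: "inverse (1 - fps_X ^ w) = (Abs_fps (\<lambda>_. 1) oo fps_X ^ w :: rat fps)" if "w > 0" for w
  proof -
    have "inverse (1 - fps_X :: rat fps) = Abs_fps (\<lambda>_. 1)"
      using fps_inverse_gp' by (metis fps_inverse_idempotent fps_nth_Abs_fps zero_neq_one)
    then show ?thesis
      using fps_inverse_compose[of "fps_X ^ w" "1 - fps_X :: rat fps"] that
      by (simp add: one_minus_X_compose_X_power)
  qed
  have "truncated_product (- 1) (SDIM_minus TYPE('a) q) (SDIM_plus TYPE('a) q) N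
      = (\<Prod>P\<in>orbits N. inverse (1 - fps_X ^ ?w P))"
    unfolding truncated_product_minus_1 by (rule prod_orbits[symmetric])
  also have "\<dots> = (\<Prod>P\<in>orbits N. Abs_fps (\<lambda>_. 1) oo fps_X ^ ?w P)"
    using factor prod_orbit(2) by (intro prod.cong) auto
  also have "\<dots> $ n = (\<Sum>M\<in>weighted_multisets (orbits N) ?w n. 1)"
    using fps_nth_prod_weighted_multisets[of "orbits N" ?w n "\<lambda>_ _. 1 :: rat"] prod_orbit(2) finite_orbits(3)
    by auto
  finally show ?thesis
    using card_weighted_multisets_orbits[OF assms] by simp
qed

text \<open>From index 2 on the counts satisfy the recurrence with factor \<open>q\<close>, so only
  the coefficients at 0 and 1 survive: 1 and \<open>(q + 1) - q = 1\<close>.\<close>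

lemma self_dual_monics_series:
  "Abs_fps (\<lambda>n. of_nat (card (self_dual_monics n))) * (1 - fps_const (of_nat q) * fps_X) = (1 + fps_X :: rat fps)"
proof (rule fps_ext)
  fix n
  show "(Abs_fps (\<lambda>n. of_nat (card (self_dual_monics n))) * (1 - fps_const (of_nat q) * fps_X)) $ n
    = (1 + fps_X :: rat fps) $ n"
  proof (cases n)
    case 0
    then show ?thesis by (simp add: self_dual_monics_0)
  next
    case (Suc m)
    have "(Abs_fps (\<lambda>n. of_nat (card (self_dual_monics n))) * (1 - fps_const (of_nat q) * fps_X)) $ n
      = of_nat (card (self_dual_monics (Suc m))) - of_nat q * (of_nat (card (self_dual_monics m)) :: rat)"
      by (simp add: Suc right_diff_distrib mult.left_commute flip: mult.assoc)
    then show ?thesis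
      by (cases m) (simp_all add: Suc card_self_dual_monics self_dual_monics_0 algebra_simps)
  qed
qed

end

theorem theorem6p5:
  fixes q :: nat and \<epsilon> :: int
  assumes "primepow q"
    and "CARD('a::{field,finite}) = q ^ 2"
    and "\<epsilon> \<in> {-1, 1}"
  shows "(1 + Abs_fps (\<lambda>n. if n \<ge> 1 then partition_coeff \<epsilon> (SDIM_minus TYPE('a) q) n else 0))
       * (1 + (Abs_fps (\<lambda>n. if n \<ge> 1 then partition_coeff \<epsilon> (SDIM_plus TYPE('a) q) n else 0)
               oo fps_X ^ 2))
       = ((1 - fps_const (of_nat q) * fps_X) / (1 + fps_X) :: rat fps) powi \<epsilon>"
proof -
  interpret quadratic_field q "TYPE('a)"
    using assms by unfold_locales
  let ?S = "SDIM_minus TYPE('a) q" and ?S' = "SDIM_plus TYPE('a) q"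
  define L where "L \<epsilon> = partition_series \<epsilon> ?S * (partition_series \<epsilon> ?S' oo fps_X ^ 2)" for \<epsilon>
  have L: "L \<epsilon> $ n = truncated_product \<epsilon> ?S ?S' N $ n" if "n \<le> N" for \<epsilon> n N
    unfolding L_def using that by (rule partition_series_mult_nth)
  let ?r = "(1 - fps_const (of_nat q) * fps_X) / (1 + fps_X) :: rat fps"
  have "L (- 1) = Abs_fps (\<lambda>n. of_nat (card (self_dual_monics n)))"
    using L[OF le_refl] truncated_product_nth[OF le_refl] by (simp add: fps_eq_iff)
  then have "L (- 1) * (1 - fps_const (of_nat q) * fps_X) = 1 + fps_X"
    by (simp add: self_dual_monics_series)
  then have r: "L (- 1) * ?r = 1"
    by (simp add: fps_divide_unit inverse_mult_eq_1' flip: mult.assoc)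
  have one: "L 1 * L (- 1) = 1"
  proof (rule fps_ext)
    fix n
    \<comment> \<open>Truncating at the coefficient in question reduces the claim to finite
      products, which are mutually inverse.\<close>
    have "(L 1 * L (- 1)) $ n = (truncated_product 1 ?S ?S' n * truncated_product (- 1) ?S ?S' n) $ n"
      by (intro fps_nth_mult_cong L)
    then show "(L 1 * L (- 1)) $ n = 1 $ n"
      by (simp add: truncated_product_mult)
  qed
  \<comment> \<open>Uniqueness of inverses: both \<open>L 1\<close> and \<open>?r\<close> are
    inverse to \<open>L (- 1)\<close>.\<close>
  have "L 1 = L 1 * (L (- 1) * ?r)"
    by (simp only: r mult_1_right)
  also have "\<dots> = ?r"
    by (simp only: one mult_1_left flip: mult.assoc)
  finally have "L 1 = ?r" .
  moreover have "inverse ?r = L (- 1)"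
    using r by (intro fps_inverse_unique) (simp only: mult.commute)
  ultimately have "L \<epsilon> = ?r powi \<epsilon>"
    using assms(3) by (auto simp: power_int_def)
  moreover have "1 + (Abs_fps (\<lambda>n. if n \<ge> 1 then partition_coeff \<epsilon> ?S' n else 0) oo fps_X ^ 2)
      = partition_series \<epsilon> ?S' oo fps_X ^ 2"
    by (simp add: partition_series_def fps_compose_add_distrib)
  ultimately show ?thesis
    by (simp add: L_def partition_series_def)
qed

end
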